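(* Let $\mathbf I=(I,\rightarrow,0)$ be an implication orthomodular poset of finite height and define, for $x,y\in I$: $x\leq y$ iff $x\rightarrow y=1$; $x':=x\rightarrow0$; $1:=0'$. Then $\mathbb P(\mathbf I):=(I,\leq,{}',0,1)$ is an orthomodular poset of finite height.
   Context: An implication orthomodular poset is a triple $(I,\rightarrow,0)$ with $0\in I$ and $\rightarrow$ a mapping from $I^2$ to nonempty subsets of $I$, with abbreviations $x':=x\rightarrow0$, $1:=0'$; singletons are identified with their elements, subsets occurring as arguments of $\rightarrow$ are treated elementwise, and for subsets $A,B$ the equation $A\rightarrow B=1$ means (convention (G)) that for every $a\in A$ there is $b\in B$ with $a\rightarrow b=1$; and for all $x,y,z\in I$: (O1) $0\rightarrow x=x\rightarrow x=1$; (O2) $x\rightarrow y=y\rightarrow x=1$ implies $x=y$; (O3) $x\rightarrow y=y\rightarrow z=1$ implies $x\rightarrow z=1$; (O4) $x''=x$; (O5) $x\rightarrow y=1$ implies $(y\rightarrow z)\rightarrow(x\rightarrow z)=1$; (O6) $x\rightarrow y=1$ implies $(((y'\rightarrow x)\rightarrow x)'\rightarrow x)\rightarrow x=y$; (O7) $x\rightarrow y'=1$ implies $x\rightarrow((x\rightarrow y)\rightarrow y)=y\rightarrow((x\rightarrow y)\rightarrow y)=1$; (O8) $x\rightarrow y'=x\rightarrow z=y\rightarrow z=1$ implies $((x\rightarrow y)\rightarrow y)\rightarrow z=1$; (O9) $(x'\rightarrow x)\rightarrow x=1$; (O10) $x\rightarrow(y\rightarrow x)=1$. Finite height of $\mathbf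 I$: there is no infinite sequence $a_1,a_2,\ldots$ of pairwise different elements with $a_n\rightarrow a_{n+1}=1$ for all $n$. Orthomodular poset: $(P,\leq,{}',0,1)$ with $(P,\leq,0,1)$ a bounded poset, $'$ an antitone involution ($x\leq y\Rightarrow y'\leq x'$, $x''=x$), such that the supremum $x\vee y$ exists whenever $x\leq y'$, $x\vee x'=1$, $x\wedge x'=0$, and $x\leq y$ implies $(y'\vee x)'\vee x=y$. Finite height of a poset: every chain is finite. *)

theory Defs
  imports "HOL-Algebra.Lattice"
begin

text \<open>
  The arrow is set-valued. Elements are identified with singletons, so all terms built from the
  arrow are sets here, an element \<open>x\<close> occurring in them as \<open>{x}\<close>.
\<close>

record 'a imp_structure = "'a partial_object" +
  arr :: "'a \<Rightarrow> 'a \<Rightarrow> 'a set"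
  bot_elem :: 'a

definition imp :: "('a, 'm) imp_structure_scheme \<Rightarrow> 'a set \<Rightarrow> 'a set \<Rightarrow> 'a set"
    (infixl \<open>\<leadsto>\<index>\<close> 65)
  where "A \<leadsto>\<^bsub>S\<^esub> B = (\<Union>a\<in>A. \<Union>b\<in>B. arr S a b)"

definition neg :: "('a, 'm) imp_structure_scheme \<Rightarrow> 'a set \<Rightarrow> 'a set" (\<open>\<sim>\<index> _\<close> [90] 90)
  where "\<sim>\<^bsub>S\<^esub> A = A \<leadsto>\<^bsub>S\<^esub> {bot_elem S}"

definition unit_set :: "('a, 'm) imp_structure_scheme \<Rightarrow> 'a set"
  where "unit_set S = \<sim>\<^bsub>S\<^esub> {bot_elem S}"

text \<open>Convention (G): the meaning of \<open>A \<rightarrow> B = 1\<close> for sets. For singletons \<open>{a}\<close>, \<open>{b}\<close> it is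
  the plain equation \<open>a \<rightarrow> b = 1\<close>.\<close>

definition imp_one :: "('a, 'm) imp_structure_scheme \<Rightarrow> 'a set \<Rightarrow> 'a set \<Rightarrow> bool"
    (infix \<open>\<lesssim>\<index>\<close> 50)
  where "A \<lesssim>\<^bsub>S\<^esub> B \<longleftrightarrow> (\<forall>a\<in>A. \<exists>b\<in>B. arr S a b = unit_set S)"

locale implication_orthomodular_poset =
  fixes S :: "('a, 'm) imp_structure_scheme" (structure)
  assumes bot_closed: "bot_elem S \<in> carrier S"
    and arr_closed: "\<lbrakk>x \<in> carrier S; y \<in> carrier S\<rbrakk> \<Longrightarrow> arr S x y \<subseteq> carrier S"
    and arr_nonempty: "\<lbrakk>x \<in> carrier S; y \<in> carrier S\<rbrakk> \<Longrightarrow> arr S x y \<noteq> {}"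
    and O1: "x \<in> carrier S \<Longrightarrow> {bot_elem S} \<lesssim> {x} \<and> {x} \<lesssim> {x}"
    and O2: "\<lbrakk>x \<in> carrier S; y \<in> carrier S; {x} \<lesssim> {y}; {y} \<lesssim> {x}\<rbrakk> \<Longrightarrow> x = y"
    and O3: "\<lbrakk>x \<in> carrier S; y \<in> carrier S; z \<in> carrier S; {x} \<lesssim> {y}; {y} \<lesssim> {z}\<rbrakk>
      \<Longrightarrow> {x} \<lesssim> {z}"
    and O4: "x \<in> carrier S \<Longrightarrow> \<sim>(\<sim>{x}) = {x}"
    and O5: "\<lbrakk>x \<in> carrier S; y \<in> carrier S; z \<in> carrier S; {x} \<lesssim> {y}\<rbrakk>
      \<Longrightarrow> ({y} \<leadsto> {z}) \<lesssim> ({x} \<leadsto> {z})"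
    and O6: "\<lbrakk>x \<in> carrier S; y \<in> carrier S; {x} \<lesssim> {y}\<rbrakk>
      \<Longrightarrow> (\<sim>((\<sim>{y} \<leadsto> {x}) \<leadsto> {x}) \<leadsto> {x}) \<leadsto> {x} = {y}"
    and O7: "\<lbrakk>x \<in> carrier S; y \<in> carrier S; {x} \<lesssim> \<sim>{y}\<rbrakk>
      \<Longrightarrow> {x} \<lesssim> (({x} \<leadsto> {y}) \<leadsto> {y}) \<and> {y} \<lesssim> (({x} \<leadsto> {y}) \<leadsto> {y})"
    and O8: "\<lbrakk>x \<in> carrier S; y \<in> carrier S; z \<in> carrier S;
        {x} \<lesssim> \<sim>{y}; {x} \<lesssim> {z}; {y} \<lesssim> {z}\<rbrakk>
      \<Longrightarrow> (({x} \<leadsto> {y}) \<leadsto> {y}) \<lesssim> {z}"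
    and O9: "x \<in> carrier S \<Longrightarrow> (\<sim>{x} \<leadsto> {x}) \<lesssim> {x}"
    and O10: "\<lbrakk>x \<in> carrier S; y \<in> carrier S\<rbrakk> \<Longrightarrow> {x} \<lesssim> ({y} \<leadsto> {x})"

definition imp_finite_height :: "('a, 'm) imp_structure_scheme \<Rightarrow> bool"
  where "imp_finite_height S \<longleftrightarrow>
    \<not> (\<exists>a :: nat \<Rightarrow> 'a. range a \<subseteq> carrier S \<and> inj a \<and> (\<forall>n. {a n} \<lesssim>\<^bsub>S\<^esub> {a (Suc n)}))"

text \<open>By (O4), \<open>x'\<close> is always a singleton, so that \<open>the_elem\<close> below extracts its element.\<close>

lemma (in implication_orthomodular_poset) neg_singleton:
  assumes x: "x \<in> carrier S"
  shows "\<exists>y\<in>carrier S. \<sim>{x} = {y}"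
proof -
  have neg: "\<sim>{u} = arr S u (bot_elem S)" for u
    by (simp add: neg_def imp_def)
  obtain a where a: "a \<in> \<sim>{x}" "a \<in> carrier S"
    using arr_nonempty[OF x bot_closed] arr_closed[OF x bot_closed] by (auto simp: neg)
  have eq: "\<sim>{b} = {x}" if b: "b \<in> \<sim>{x}" for b
  proof -
    have "b \<in> carrier S" using b arr_closed[OF x bot_closed] by (auto simp: neg)
    then have "\<sim>{b} \<noteq> {}" using arr_nonempty bot_closed by (auto simp: neg)
    moreover have "\<sim>{b} \<subseteq> \<sim>(\<sim>{x})" using b by (auto simp: neg_def imp_def)
    ultimately show ?thesis using O4[OF x] by auto
  qed
  have "\<sim>{x} = {a}" using O4[OF a(2)] eq[OF a(1)] by simp
  then show ?thesis using a(2) by blast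
qed

record 'a ortho_structure = "'a gorder" +
  ocompl :: "'a \<Rightarrow> 'a"
  ozero :: 'a
  oone :: 'a

text \<open>The supremum \<open>x \<squnion> y\<close> of the library is an arbitrary value unless the supremum exists. In
  the last two axioms existence follows from the axiom \<open>orthogonal_sup\<close>, the arguments being
  orthogonal.\<close>

locale orthomodular_poset = partial_order P
  for P :: "('a, 'm) ortho_structure_scheme" (structure) +
  assumes zero_closed: "ozero P \<in> carrier P"
    and one_closed: "oone P \<in> carrier P"
    and zero_least: "x \<in> carrier P \<Longrightarrow> ozero P \<sqsubseteq> x"
    and one_greatest: "x \<in> carrier P \<Longrightarrow> x \<sqsubseteq> oone P"
    and compl_closed: "x \<in> carrier P \<Longrightarrow> ocompl P x \<in> carrier P"
    and compl_antitone:
      "\<lbrakk>x \<in> carrier P; y \<in> carrier P; x \<sqsubseteq> y\<rbrakk> \<Longrightarrow> ocompl P y \<sqsubseteq> ocompl P x"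
    and compl_involution: "x \<in> carrier P \<Longrightarrow> ocompl P (ocompl P x) = x"
    and orthogonal_sup:
      "\<lbrakk>x \<in> carrier P; y \<in> carrier P; x \<sqsubseteq> ocompl P y\<rbrakk> \<Longrightarrow> \<exists>s. is_lub P s {x, y}"
    and compl_inf: "x \<in> carrier P \<Longrightarrow> is_glb P (ozero P) {x, ocompl P x}"
    and compl_sup: "x \<in> carrier P \<Longrightarrow> x \<squnion> ocompl P x = oone P"
    and orthomodular:
      "\<lbrakk>x \<in> carrier P; y \<in> carrier P; x \<sqsubseteq> y\<rbrakk> \<Longrightarrow> ocompl P (ocompl P y \<squnion> x) \<squnion> x = y"

definition poset_finite_height :: "('a, 'm) gorder_scheme \<Rightarrow> bool"
  where "poset_finite_height P \<longleftrightarrow>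
    (\<forall>C. C \<subseteq> carrier P \<and> Complete_Partial_Order.chain (le P) C \<longrightarrow> finite C)"

definition induced_poset :: "('a, 'm) imp_structure_scheme \<Rightarrow> 'a ortho_structure"
  where "induced_poset S =
    \<lparr>carrier = carrier S, eq = (=), le = (\<lambda>x y. {x} \<lesssim>\<^bsub>S\<^esub> {y}),
     ocompl = (\<lambda>x. the_elem (\<sim>\<^bsub>S\<^esub> {x})), ozero = bot_elem S, oone = the_elem (unit_set S)\<rparr>"

end

theory Submission
  imports Defs "HOL-Library.Ramsey"
begin

text \<open>
  The delicate point is the existence of \<open>x \<squnion> y\<close> for \<open>x \<le> y'\<close>: the term \<open>(x \<rightarrow> y) \<rightarrow> y\<close> is a set,
  all of whose elements lie below every upper bound of \<open>x\<close> and \<open>y\<close> by (O8), but (O7) only provides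
  one element above \<open>x\<close> and a possibly different one \<open>c\<close> above \<open>y\<close>. Now (O6), applied to \<open>y \<le> x'\<close>,
  gives \<open>(c' \<rightarrow> y) \<rightarrow> y = {x'}\<close>, so (O7) for \<open>c' \<le> y'\<close> yields \<open>c' \<le> x'\<close>, that is, \<open>x \<le> c\<close>.
  Hence \<open>c\<close> is the supremum of \<open>x\<close> and \<open>y\<close>, and the same instance of (O6) is the orthomodular law.
  An infinite chain contains an infinite monotone sequence by Ramsey's theorem, and
  complementation turns a decreasing sequence into an increasing one.
\<close>

section \<open>Monotone sequences in infinite chains\<close>

lemma infinite_chain_monotone_sequence:
  assumes "Complete_Partial_Order.chain r C" and "infinite C"
  obtains a :: "nat \<Rightarrow> 'a" where "range a \<subseteq> C" "inj a"
    "(\<forall>n. r (a n) (a (Suc n))) \<or> (\<forall>n. r (a (Suc n)) (a n))"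
proof -
  obtain g :: "nat \<Rightarrow> 'a" where g: "inj g" "range g \<subseteq> C"
    using infinite_countable_subset[OF assms(2)] by blast
  \<comment> \<open>\<open>Min\<close> and \<open>Max\<close> recover the order of the two indices
    from the unordered pair; colour 0 means that \<open>g\<close> ascends from the smaller index to
    the larger.\<close>
  define col where "col X = (if r (g (Min X)) (g (Max X)) then 0 else 1 :: nat)" for X
  obtain Y t where Y: "infinite Y" "\<forall>i\<in>Y. \<forall>j\<in>Y. i \<noteq> j \<longrightarrow> col {i, j} = t"
  proof -
    have "\<forall>i\<in>UNIV. \<forall>j\<in>UNIV. i \<noteq> j \<longrightarrow> col {i, j} < 2" by (simp add: col_def)
    from Ramsey2[OF infinite_UNIV_nat this] that show thesis by blast
  qed
  define a where "a = g \<circ> enumerate Y"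
  have inj: "inj a"
    unfolding a_def using g(1) strict_mono_enumerate[OF Y(1)]
    by (intro inj_compose) (auto simp: strict_mono_imp_inj_on)
  have "range a \<subseteq> C" using g(2) by (auto simp: a_def)
  \<comment> \<open>\<open>enumerate\<close> lists \<open>Y\<close> increasingly, so the earlier of
    two consecutive indices is the \<open>Min\<close> of the pair.\<close>
  have col: "col {enumerate Y n, enumerate Y (Suc n)}
      = (if r (a n) (a (Suc n)) then 0 else 1)" for n
    using enumerate_step[OF Y(1), of n] by (simp add: col_def a_def)
  have const: "col {enumerate Y n, enumerate Y (Suc n)} = t" for n
    using Y enumerate_step[OF Y(1), of n] enumerate_in_set[OF Y(1)] by (metis less_irrefl)
  have "(\<forall>n. r (a n) (a (Suc n))) \<or> (\<forall>n. r (a (Suc n)) (a n))"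
  proof (cases "t = 0")
    case True
    then have "r (a n) (a (Suc n))" for n
      using const[of n] col[of n] by (auto split: if_splits)
    then show ?thesis by blast
  next
    case False
    then have "\<not> r (a n) (a (Suc n))" for n
      using const[of n] col[of n] by (auto split: if_splits)
    \<comment> \<open>Any two members of a chain are comparable, so failing to ascend means
      descending.\<close>
    then have "r (a (Suc n)) (a n)" for n
      using assms(1) \<open>range a \<subseteq> C\<close> unfolding Complete_Partial_Order.chain_def by blast
    then show ?thesis by blast
  qed
  with \<open>range a \<subseteq> C\<close> inj show thesis by (rule that)
qed

no_notation lepoll (infixl \<open>\<lesssim>\<close> 50)

section \<open>Order and complement given by the arrow\<close>

context implication_orthomodular_poset
begin

abbreviation leq :: "'a \<Rightarrow> 'a \<Rightarrow> bool" (infix \<open>\<preceq>\<close> 50)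
  where "x \<preceq> y \<equiv> {x} \<lesssim> {y}"

definition compl :: "'a \<Rightarrow> 'a"
  where "compl x = the_elem (\<sim>{x})"

definition top_elem :: 'a
  where "top_elem = compl (bot_elem S)"

lemma neg_eq: "x \<in> carrier S \<Longrightarrow> \<sim>{x} = {compl x}"
  unfolding compl_def using neg_singleton[of x] by (metis the_elem_eq)

lemma compl_closed: "x \<in> carrier S \<Longrightarrow> compl x \<in> carrier S"
  using neg_singleton[of x] neg_eq[of x] by (metis singleton_inject)

lemma compl_compl: "x \<in> carrier S \<Longrightarrow> compl (compl x) = x"
  using O4[of x] by (simp add: neg_eq compl_closed)

lemma unit_set_eq: "unit_set S = {top_elem}"
  by (simp add: unit_set_def neg_eq bot_closed top_elem_def)

lemma top_closed: "top_elem \<in> carrier S"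
  by (simp add: top_elem_def compl_closed bot_closed)

lemma leq_iff: "x \<preceq> y \<longleftrightarrow> arr S x y = {top_elem}"
  by (simp add: imp_one_def unit_set_eq)

lemma imp_one_singletonD: "\<lbrakk>A \<lesssim> {z}; a \<in> A\<rbrakk> \<Longrightarrow> a \<preceq> z"
  by (simp add: imp_one_def)

lemma singleton_imp_oneE:
  assumes "{y} \<lesssim> B"
  obtains b where "b \<in> B" "y \<preceq> b"
  using assms by (auto simp: imp_one_def)

lemma compl_antimono: "\<lbrakk>x \<in> carrier S; y \<in> carrier S; x \<preceq> y\<rbrakk> \<Longrightarrow> compl y \<preceq> compl x"
  using O5[of x y "bot_elem S"] bot_closed by (simp add: neg_def[symmetric] neg_eq)

lemma compl_leq_swap:
  "\<lbrakk>x \<in> carrier S; y \<in> carrier S; x \<preceq> compl y\<rbrakk> \<Longrightarrow> y \<preceq> compl x"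
  using compl_antimono[of x "compl y"] by (simp add: compl_closed compl_compl)

lemma leq_top: "x \<in> carrier S \<Longrightarrow> x \<preceq> top_elem"
  unfolding top_elem_def using O1[OF compl_closed] compl_leq_swap[OF bot_closed] by blast

lemma imp_mono: "\<lbrakk>A \<subseteq> A'; B \<subseteq> B'\<rbrakk> \<Longrightarrow> A \<leadsto> B \<subseteq> A' \<leadsto> B'"
  by (auto simp: imp_def)

lemma imp_closed: "\<lbrakk>A \<subseteq> carrier S; B \<subseteq> carrier S\<rbrakk> \<Longrightarrow> A \<leadsto> B \<subseteq> carrier S"
  using arr_closed unfolding imp_def by blast

lemma imp_nonempty:
  assumes "A \<subseteq> carrier S" "B \<subseteq> carrier S" "A \<noteq> {}" "B \<noteq> {}"
  shows "A \<leadsto> B \<noteq> {}"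
proof -
  obtain a b where "a \<in> A" "b \<in> B" using assms(3,4) by blast
  moreover from this obtain c where "c \<in> arr S a b"
    using arr_nonempty[of a b] assms(1,2) by blast
  ultimately have "c \<in> A \<leadsto> B" unfolding imp_def by blast
  then show ?thesis by blast
qed

section \<open>Suprema of orthogonal elements\<close>

lemma join_term_closed:
  "\<lbrakk>x \<in> carrier S; y \<in> carrier S\<rbrakk> \<Longrightarrow> ({x} \<leadsto> {y}) \<leadsto> {y} \<subseteq> carrier S"
  by (intro imp_closed) auto

lemma join_term_nonempty:
  "\<lbrakk>x \<in> carrier S; y \<in> carrier S\<rbrakk> \<Longrightarrow> ({x} \<leadsto> {y}) \<leadsto> {y} \<noteq> {}"
  by (intro imp_nonempty imp_closed) auto

abbreviation is_join :: "'a \<Rightarrow> 'a \<Rightarrow> 'a \<Rightarrow> bool"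
  where "is_join s x y \<equiv> s \<in> carrier S \<and> x \<preceq> s \<and> y \<preceq> s \<and>
    (\<forall>z\<in>carrier S. x \<preceq> z \<longrightarrow> y \<preceq> z \<longrightarrow> s \<preceq> z)"

text \<open>By convention (G), (O8) bounds each element of the term separately, so leastness is
  automatic for whichever element turns out to be an upper bound.\<close>

lemma is_join_if_upper_bound:
  assumes "x \<in> carrier S" "y \<in> carrier S" "x \<preceq> compl y"
    and "c \<in> ({x} \<leadsto> {y}) \<leadsto> {y}" "x \<preceq> c" "y \<preceq> c"
  shows "is_join c x y"
proof -
  have "c \<in> carrier S"
    using assms(4) join_term_closed[OF assms(1,2)] by blast
  moreover have "c \<preceq> z" if "z \<in> carrier S" "x \<preceq> z" "y \<preceq> z" for z
  proof -
    have "(({x} \<leadsto> {y}) \<leadsto> {y}) \<lesssim> {z}"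
      using O8[of x y z] assms(1-3) that by (simp add: neg_eq)
    then show ?thesis using assms(4) by (rule imp_one_singletonD)
  qed
  ultimately show ?thesis using assms(5,6) by blast
qed

text \<open>The last conclusion is the orthomodular law for \<open>y \<preceq> compl x\<close>, with
  \<open>c\<close> the supremum of \<open>x\<close> and \<open>y\<close>. Membership of
  \<open>c\<close> in the term is recorded because \<open>compl_join\<close> computes that
  term.\<close>

lemma orthogonal_join:
  assumes x: "x \<in> carrier S" and y: "y \<in> carrier S" and orth: "x \<preceq> compl y"
  obtains c where "c \<in> ({x} \<leadsto> {y}) \<leadsto> {y}" "is_join c x y" "is_join (compl x) (compl c) y"
proof -
  let ?U = "({x} \<leadsto> {y}) \<leadsto> {y}"
  obtain c where c: "c \<in> ?U" "y \<preceq> c"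
    using O7[OF x y] orth unfolding neg_eq[OF y] by (blast elim: singleton_imp_oneE)
  have c_closed: "c \<in> carrier S"
    using c(1) join_term_closed[OF x y] by blast
  then have c'_closed: "compl c \<in> carrier S" by (rule compl_closed)
  have c'y: "compl c \<preceq> compl y" using y c_closed c(2) by (rule compl_antimono)
  \<comment> \<open>The term in (O6) runs through the complements of all elements of
    \<open>?U\<close>. Restricting it to \<open>compl c\<close> can only shrink it, and since the
    smaller term is nonempty, it still equals the singleton.\<close>
  have "({compl c} \<leadsto> {y}) \<leadsto> {y} \<subseteq> (\<sim>?U \<leadsto> {y}) \<leadsto> {y}"
  proof (intro imp_mono order_refl)
    show "{compl c} \<subseteq> \<sim>?U"
      using c(1) unfolding neg_eq[OF c_closed, symmetric] neg_def by (intro imp_mono) auto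
  qed
  also have "\<dots> = {compl x}"
    using O6[of y "compl x"] x y compl_leq_swap[OF x y orth]
    by (simp add: neg_eq compl_closed compl_compl)
  finally have sing: "({compl c} \<leadsto> {y}) \<leadsto> {y} = {compl x}"
    using join_term_nonempty[OF c'_closed y] by blast
  \<comment> \<open>The term is now a singleton, so both witnesses of (O7) must be
    \<open>compl x\<close>.\<close>
  then have "compl c \<preceq> compl x" "y \<preceq> compl x"
    using O7[OF c'_closed y] c'y by (simp_all add: neg_eq y)
  then have "is_join (compl x) (compl c) y"
    using sing by (intro is_join_if_upper_bound[OF c'_closed y c'y]) simp_all
  moreover have "x \<preceq> c"
    using compl_leq_swap[OF c'_closed x \<open>compl c \<preceq> compl x\<close>] by (simp add: compl_compl c_closed)
  ultimately show thesis
    using that c is_join_if_upper_bound[OF x y orth] by blast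
qed

text \<open>By (O9) every \<open>a\<close> in \<open>{compl x} \<leadsto> {x}\<close> lies below
  \<open>x\<close>, so \<open>arr S a x\<close> is \<open>{top_elem}\<close> and the whole join term
  collapses to it. The supremum found in that term is therefore \<open>top_elem\<close>.\<close>

lemma compl_join:
  assumes x: "x \<in> carrier S"
  shows "is_join top_elem x (compl x)"
proof -
  have x': "compl x \<in> carrier S" using x by (rule compl_closed)
  have refl: "compl x \<preceq> compl x" using O1[OF x'] by blast
  obtain c where c: "c \<in> ({compl x} \<leadsto> {x}) \<leadsto> {x}" "is_join c (compl x) x"
      "is_join (compl (compl x)) (compl c) x"
    by (rule orthogonal_join[OF x' x refl])
  have "({compl x} \<leadsto> {x}) \<lesssim> {x}" using O9[OF x] by (simp add: neg_eq x)
  then have "arr S a x = {top_elem}" if "a \<in> {compl x} \<leadsto> {x}" for a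
    using that by (simp add: imp_one_singletonD leq_iff[symmetric])
  then have "({compl x} \<leadsto> {x}) \<leadsto> {x} \<subseteq> {top_elem}"
    unfolding imp_def[of S "{compl x} \<leadsto> {x}"] by simp
  with c show ?thesis by auto
qed

text \<open>De Morgan dual of \<open>compl_join\<close>: \<open>compl z\<close> is an upper bound of
  \<open>x\<close> and \<open>compl x\<close>, hence above \<open>top_elem\<close>.\<close>

lemma compl_meet:
  assumes "x \<in> carrier S" "z \<in> carrier S" "z \<preceq> x" "z \<preceq> compl x"
  shows "z \<preceq> bot_elem S"
proof -
  have "top_elem \<preceq> compl z"
    using compl_join[OF assms(1)] assms compl_antimono[of z x] compl_leq_swap[of z x]
    by (auto simp: compl_closed)
  then have "z \<preceq> compl top_elem"
    using compl_leq_swap top_closed assms(2) by blast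
  then show ?thesis by (simp add: top_elem_def compl_compl bot_closed)
qed

section \<open>The induced orthomodular poset\<close>

lemma induced_poset_simps:
  "carrier (induced_poset S) = carrier S"
  "le (induced_poset S) = (\<lambda>x y. x \<preceq> y)"
  "eq (induced_poset S) = (=)"
  "ocompl (induced_poset S) = compl"
  "ozero (induced_poset S) = bot_elem S"
  "oone (induced_poset S) = top_elem"
  by (auto simp: induced_poset_def compl_def unit_set_eq)

lemma is_lub_iff_is_join:
  assumes "x \<in> carrier S" "y \<in> carrier S"
  shows "is_lub (induced_poset S) s {x, y} \<longleftrightarrow> is_join s x y"
  using assms by (auto simp: least_def Upper_def induced_poset_simps)

text \<open>The library join is a choice among least upper bounds; antisymmetry (O2) leaves only
  one.\<close>

lemma join_eqI:
  assumes "x \<in> carrier S" "y \<in> carrier S" "is_join s x y"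
  shows "x \<squnion>\<^bsub>induced_poset S\<^esub> y = s"
  unfolding join_def sup_def
  using assms by (intro some_equality) (auto simp: is_lub_iff_is_join intro: O2)

lemma orthomodular_poset_induced: "orthomodular_poset (induced_poset S)"
proof -
  have om: "compl (compl y \<squnion>\<^bsub>induced_poset S\<^esub> x) \<squnion>\<^bsub>induced_poset S\<^esub> x = y"
    if xy: "x \<in> carrier S" "y \<in> carrier S" "x \<preceq> y" for x y
  proof -
    have y': "compl y \<in> carrier S" using xy(2) by (rule compl_closed)
    \<comment> \<open>From \<open>x \<preceq> y\<close> the elements \<open>compl y\<close> and
      \<open>x\<close> are orthogonal; \<open>c\<close> is the inner join of the law, and the second
      fact on \<open>c\<close> is the outer one.\<close>
    obtain c where "c \<in> ({compl y} \<leadsto> {x}) \<leadsto> {x}"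
      and c: "is_join c (compl y) x" "is_join (compl (compl y)) (compl c) x"
      by (rule orthogonal_join[OF y' xy(1) compl_antimono[OF xy]])
    then have "compl c \<in> carrier S" by (intro compl_closed) blast
    then show ?thesis
      using join_eqI[OF y' xy(1) c(1)] join_eqI[OF _ xy(1) c(2)] by (simp add: compl_compl xy(2))
  qed
  have "partial_order (induced_poset S)"
    using O1 O2 O3 by unfold_locales (unfold induced_poset_simps, blast+)
  moreover have "\<exists>s. is_lub (induced_poset S) s {x, y}"
    if "x \<in> carrier S" "y \<in> carrier S" "x \<preceq> compl y" for x y
    unfolding is_lub_iff_is_join[OF that(1,2)] by (rule orthogonal_join[OF that], rule exI)
  moreover have "is_glb (induced_poset S) (bot_elem S) {x, compl x}" if "x \<in> carrier S" for x
    using that O1[OF that] O1[OF compl_closed[OF that]]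
    by (auto simp: greatest_def Lower_def induced_poset_simps bot_closed compl_closed
        intro: compl_meet[OF that])
  moreover have "x \<squnion>\<^bsub>induced_poset S\<^esub> compl x = top_elem" if "x \<in> carrier S" for x
    using that by (intro join_eqI compl_join compl_closed)
  ultimately show ?thesis
    unfolding orthomodular_poset_def orthomodular_poset_axioms_def induced_poset_simps
    using bot_closed top_closed O1 leq_top compl_closed compl_antimono compl_compl om by simp
qed

section \<open>Finite height\<close>

lemma poset_finite_height_induced:
  assumes "imp_finite_height S"
  shows "poset_finite_height (induced_poset S)"
  unfolding poset_finite_height_def
proof (intro allI impI, elim conjE, rule ccontr)
  fix C assume C: "C \<subseteq> carrier (induced_poset S)"
    "Complete_Partial_Order.chain (le (induced_poset S)) C" "infinite C"
  obtain a :: "nat \<Rightarrow> 'a" where a: "range a \<subseteq> C" "inj a"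
      "(\<forall>n. a n \<preceq> a (Suc n)) \<or> (\<forall>n. a (Suc n) \<preceq> a n)"
    using infinite_chain_monotone_sequence[OF C(2,3)] by (auto simp: induced_poset_simps)
  have car: "a n \<in> carrier S" for n
    using a(1) C(1) by (auto simp: induced_poset_simps)
  have no_ascending: False
    if "\<And>n. b n \<in> carrier S" "inj b" "\<And>n. b n \<preceq> b (Suc n)" for b :: "nat \<Rightarrow> 'a"
    using assms unfolding imp_finite_height_def
    by (rule notE, intro exI[of _ b] conjI image_subsetI allI that)
  from a(3) show False
  proof
    assume "\<forall>n. a n \<preceq> a (Suc n)"
    with a(2) car show False by (intro no_ascending[of a]) simp_all
  next
    assume desc: "\<forall>n. a (Suc n) \<preceq> a n"
    \<comment> \<open>An involution is injective, so the complements of the descending sequence stay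
      pairwise different.\<close>
    have "inj_on compl (range a)"
      using car by (intro inj_on_inverseI[of _ compl]) (auto simp: compl_compl)
    then have inj: "inj (compl \<circ> a)" using a(2) by (rule comp_inj_on[rotated])
    show False
    proof (rule no_ascending[OF _ inj]; unfold o_apply)
      show "compl (a n) \<in> carrier S" for n using car by (rule compl_closed)
      show "compl (a n) \<preceq> compl (a (Suc n))" for n
        using car car desc[rule_format] by (rule compl_antimono)
    qed
  qed
qed

end

theorem theorem2p6:
  fixes S :: "'a imp_structure"
  assumes "implication_orthomodular_poset S"
    and "imp_finite_height S"
  shows "orthomodular_poset (induced_poset S) \<and> poset_finite_height (induced_poset S)"
  using assms implication_orthomodular_poset.orthomodular_poset_induced
    implication_orthomodular_poset.poset_finite_height_induced by blast

end
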